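(* Let $A$ be a real $n\times n$ nonsingular skew-symmetric matrix ($A^t=-A$) and $b\in\mathbb{R}^n$. For each integer $q\ge 0$: (i) The CGNE iterate $x^E_q$, i.e. the unique vector $x^E_q\in\mathcal{K}_q(A^2,Ab)$ satisfying $p^t(b-Ax^E_q)=0$ for all $p\in\mathcal{K}_q(A^2,b)$, lies in $\mathcal{K}_{2q}(A,b)$ and satisfies the Galerkin condition $p^t(b-Ax^E_q)=0$ for all $p\in\mathcal{K}_{2q}(A,b)$. Consequently the Galerkin iterate $x^G_{2q}$ (the unique vector in $\mathcal{K}_{2q}(A,b)$ satisfying this Galerkin condition) equals $x^E_q$. (ii) The CGNR iterate $x^R_q=\operatorname{argmin}_{z\in\mathcal{K}_q(A^2,Ab)}\|b-Az\|$ satisfies $x^R_q=\operatorname{argmin}_{z\in\mathcal{K}_{2q}(A,b)}\|b-Az\|=\operatorname{argmin}_{z\in\mathcal{K}_{2q+1}(A,b)}\|b-Az\|$; that is, with $x^M_m=\operatorname{argmin}_{z\in\mathcal{K}_m(A,b)}\|b-Az\|$ the minimum residual iterates, $x^M_{2q+1}=x^M_{2q}=x^R_q$.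
   Context: For a matrix $B$, a vector $c$ and an integer $m\ge 0$, the Krylov subspace is $\mathcal{K}_m(B,c)=\operatorname{span}\{c,Bc,\ldots,B^{m-1}c\}$ (with $\mathcal{K}_0(B,c)=\{0\}$). $\|\cdot\|$ denotes the Euclidean norm. The minimum residual iterate over a subspace is unique since $A$ is nonsingular. *)

theory Defs
  imports "HOL-Analysis.Analysis"
begin

text \<open>Krylov subspace K_m(B,c) = span{c, Bc, ..., B^(m-1) c}; K_0 = span {} = {0}.\<close>
definition krylov :: "real^'n^'n \<Rightarrow> real^'n \<Rightarrow> nat \<Rightarrow> (real^'n) set" where
  "krylov B c m = span {(((*v) B) ^^ k) c | k. k < m}"

text \<open>x lies in the search space V and the residual b - A x is orthogonal to the test space W.\<close>
definition petrov_galerkin ::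
  "(real^'n) set \<Rightarrow> (real^'n) set \<Rightarrow> real^'n^'n \<Rightarrow> real^'n \<Rightarrow> real^'n \<Rightarrow> bool" where
  "petrov_galerkin V W A b x \<longleftrightarrow> x \<in> V \<and> (\<forall>p\<in>W. p \<bullet> (b - A *v x) = 0)"

text \<open>x minimizes the residual norm over V.\<close>
definition min_residual ::
  "(real^'n) set \<Rightarrow> real^'n^'n \<Rightarrow> real^'n \<Rightarrow> real^'n \<Rightarrow> bool" where
  "min_residual V A b x \<longleftrightarrow> x \<in> V \<and> (\<forall>z\<in>V. norm (b - A *v x) \<le> norm (b - A *v z))"

end

theory Submission
  imports Defs
begin

text \<open>Write \<open>E\<^sub>k = K\<^sub>k(A\<^sup>2, b)\<close>. Splitting powers of \<open>A\<close> by parity gives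
  \<open>K\<^sub>m(A, b) = E\<^sub>\<lceil>\<^sub>m\<^sub>/\<^sub>2\<^sub>\<rceil> + A E\<^sub>\<lfloor>\<^sub>m\<^sub>/\<^sub>2\<^sub>\<rfloor>\<close>, and the CGNE/CGNR search space is \<open>A E\<^sub>q\<close>.
  For skew \<open>A\<close> the bilinear form \<open>(u, w) \<mapsto> u \<bullet> A w\<close> vanishes on \<open>E\<^sub>k\<close>, because
  \<open>b \<bullet> A\<^sup>2\<^sup>j\<^sup>+\<^sup>1 b = 0\<close>. The residual of an iterate \<open>A w\<^sub>0\<close> with \<open>w\<^sub>0 \<in> E\<^sub>q\<close> lies in
  \<open>E\<^sub>q\<^sub>+\<^sub>1\<close> and is therefore orthogonal to \<open>A E\<^sub>q\<^sub>+\<^sub>1\<close>, so the orthogonality conditions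
  over \<open>K\<^sub>2\<^sub>q\<close> and \<open>K\<^sub>2\<^sub>q\<^sub>+\<^sub>1\<close> reduce to those over \<open>E\<^sub>q\<close> and \<open>A E\<^sub>q\<close> that define CGNE and CGNR.\<close>

lemma ex1_orthogonal_projection:
  fixes W :: "'a::euclidean_space set"
  assumes "subspace W"
  shows "\<exists>!x. x \<in> W \<and> (\<forall>v\<in>W. v \<bullet> (y - x) = 0)"
proof (rule ex_ex1I)
  obtain p z where p: "p \<in> span W" and z: "\<And>w. w \<in> span W \<Longrightarrow> orthogonal z w"
    and y: "y = p + z"
    using orthogonal_subspace_decomp_exists by blast
  have "p \<in> W"
    using assms p span_eq_iff by blast
  moreover have "v \<bullet> (y - p) = 0" if "v \<in> W" for v
    using z[OF span_base[OF that]] y by (simp add: orthogonal_def inner_commute)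
  ultimately show "\<exists>x. x \<in> W \<and> (\<forall>v\<in>W. v \<bullet> (y - x) = 0)"
    by blast
next
  fix x x'
  assume x: "x \<in> W \<and> (\<forall>v\<in>W. v \<bullet> (y - x) = 0)" and x': "x' \<in> W \<and> (\<forall>v\<in>W. v \<bullet> (y - x') = 0)"
  then have "x - x' \<in> W"
    using assms subspace_diff by blast
  with x x' have "(x - x') \<bullet> ((y - x') - (y - x)) = 0"
    by (simp add: inner_diff_right)
  then show "x = x'"
    by simp
qed

subsection \<open>Minimum residual iterates\<close>

lemma residual_pythagoras:
  fixes A :: "real^'n^'m"
  assumes "subspace V" and "x \<in> V" and "z \<in> V"
    and orth: "\<forall>v\<in>V. (A *v v) \<bullet> (b - A *v x) = 0"
  shows "(norm (b - A *v z))\<^sup>2 = (norm (b - A *v x))\<^sup>2 + (norm (A *v (x - z)))\<^sup>2"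
proof -
  have "x - z \<in> V"
    using assms subspace_diff by blast
  with orth have "orthogonal (b - A *v x) (A *v (x - z))"
    by (simp add: orthogonal_def inner_commute)
  moreover have "b - A *v z = (b - A *v x) + A *v (x - z)"
    by (simp add: matrix_vector_mult_diff_distrib)
  ultimately show ?thesis
    by (simp only: norm_add_Pythagorean)
qed

lemma min_residual_if_orthogonal:
  assumes "subspace V" and "x \<in> V" and "\<forall>v\<in>V. (A *v v) \<bullet> (b - A *v x) = 0"
  shows "min_residual V A b x"
  unfolding min_residual_def
proof (intro conjI ballI)
  fix z
  assume "z \<in> V"
  then have "(norm (b - A *v x))\<^sup>2 \<le> (norm (b - A *v z))\<^sup>2"
    using residual_pythagoras[OF assms(1,2) _ assms(3)] by simp
  then show "norm (b - A *v x) \<le> norm (b - A *v z)"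
    by (rule power2_le_imp_le) simp
qed (fact assms)

lemma ex_residual_orthogonal:
  fixes A :: "real^'n^'m"
  assumes "subspace V"
  obtains x where "x \<in> V" and "\<forall>v\<in>V. (A *v v) \<bullet> (b - A *v x) = 0"
proof -
  have "subspace ((*v) A ` V)"
    using assms by (simp add: linear_subspace_image matrix_vector_mul_linear)
  then obtain y where "y \<in> (*v) A ` V" and "\<forall>v\<in>(*v) A ` V. v \<bullet> (b - y) = 0"
    using ex1_orthogonal_projection by blast
  then show thesis
    using that by blast
qed

lemma ex1_min_residual:
  fixes A :: "real^'n^'n"
  assumes "subspace V" and "invertible A"
  shows "\<exists>!x. min_residual V A b x"
proof -
  obtain x where x: "x \<in> V" and orth: "\<forall>v\<in>V. (A *v v) \<bullet> (b - A *v x) = 0"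
    using ex_residual_orthogonal[OF assms(1)] .
  have "z = x" if "min_residual V A b z" for z
  proof -
    from that have z: "z \<in> V" and "norm (b - A *v z) \<le> norm (b - A *v x)"
      using x unfolding min_residual_def by auto
    then have "(norm (b - A *v z))\<^sup>2 \<le> (norm (b - A *v x))\<^sup>2"
      by (simp add: power_mono)
    then have "A *v (x - z) = 0"
      using residual_pythagoras[OF assms(1) x z orth] by simp
    then have "x - z = 0"
      using assms(2) unfolding invertible_left_inverse matrix_left_invertible_ker by blast
    then show "z = x"
      by simp
  qed
  with min_residual_if_orthogonal[OF assms(1) x orth] show ?thesis
    by blast
qed

lemma the_min_residual_eqI:
  fixes A :: "real^'n^'n"
  assumes "subspace V" and "invertible A"
    and "x \<in> V" and "\<forall>v\<in>V. (A *v v) \<bullet> (b - A *v x) = 0"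
  shows "(THE x. min_residual V A b x) = x"
  using assms by (intro the1_equality ex1_min_residual min_residual_if_orthogonal)

subsection \<open>Normal equations\<close>

text \<open>With \<open>A x\<^sub>s = b\<close>, the Petrov--Galerkin condition with search space \<open>A\<^sup>T E\<close>
  and test space \<open>E\<close> says that \<open>x\<close> is the orthogonal projection of \<open>x\<^sub>s\<close> onto \<open>A\<^sup>T E\<close>.\<close>

lemma petrov_galerkin_transpose_image_iff:
  assumes "A *v x\<^sub>s = b"
  shows "petrov_galerkin ((*v) (transpose A) ` E) E A b x \<longleftrightarrow>
    x \<in> (*v) (transpose A) ` E \<and> (\<forall>v\<in>(*v) (transpose A) ` E. v \<bullet> (x\<^sub>s - x) = 0)"
proof -
  have "p \<bullet> (b - A *v x) = (transpose A *v p) \<bullet> (x\<^sub>s - x)" for p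
    using assms by (simp add: dot_lmul_matrix matrix_vector_mult_diff_distrib)
  then show ?thesis
    unfolding petrov_galerkin_def by auto
qed

lemma ex1_petrov_galerkin_transpose_image:
  fixes A :: "real^'n^'n"
  assumes "subspace E" and "invertible A"
  shows "\<exists>!x. petrov_galerkin ((*v) (transpose A) ` E) E A b x"
proof -
  obtain B where "A ** B = mat 1"
    using assms(2) unfolding invertible_def by blast
  then have "A *v (B *v b) = b"
    by (simp add: matrix_vector_mul_assoc)
  moreover have "subspace ((*v) (transpose A) ` E)"
    using assms(1) by (rule linear_subspace_image[OF matrix_vector_mul_linear])
  ultimately show ?thesis
    by (simp only: petrov_galerkin_transpose_image_iff ex1_orthogonal_projection)
qed

subsection \<open>Krylov subspaces\<close>

lemma subspace_krylov: "subspace (krylov B c m)"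
  unfolding krylov_def by (rule subspace_span)

lemma krylov_mono: "m \<le> n \<Longrightarrow> krylov B c m \<subseteq> krylov B c n"
  unfolding krylov_def by (rule span_mono) auto

lemma start_mem_krylov: "0 < m \<Longrightarrow> c \<in> krylov B c m"
  unfolding krylov_def by (rule span_base) (auto intro: exI[of _ 0])

lemma krylov_mult_Suc:
  assumes "w \<in> krylov B c m"
  shows "B *v w \<in> krylov B c (Suc m)"
proof -
  have "B *v w \<in> span ((*v) B ` {((*v) B ^^ k) c | k. k < m})"
    using assms unfolding krylov_def span_linear_image[OF matrix_vector_mul_linear] by blast
  also have "\<dots> \<subseteq> krylov B c (Suc m)"
    unfolding krylov_def
  proof (rule span_mono, rule subsetI)
    fix y
    assume "y \<in> (*v) B ` {((*v) B ^^ k) c | k. k < m}"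
    then obtain k where "k < m" and "y = ((*v) B ^^ Suc k) c"
      by auto
    then show "y \<in> {((*v) B ^^ k) c | k. k < Suc m}"
      by blast
  qed
  finally show ?thesis .
qed

lemma funpow_mult_square: "((*v) (A ** A) ^^ i) c = ((*v) A ^^ (2 * i)) c"
  by (induction i) (auto simp: matrix_vector_mul_assoc)

lemma krylov_square_mult_start: "krylov (A ** A) (A *v b) q = (*v) A ` krylov (A ** A) b q"
proof -
  have "((*v) (A ** A) ^^ k) (A *v b) = A *v ((*v) (A ** A) ^^ k) b" for k
    by (induction k) (auto simp: matrix_vector_mul_assoc matrix_mul_assoc)
  then have "{((*v) (A ** A) ^^ k) (A *v b) | k. k < q} = (*v) A ` {((*v) (A ** A) ^^ k) b | k. k < q}"
    by auto
  then show ?thesis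
    unfolding krylov_def by (simp add: span_linear_image[OF matrix_vector_mul_linear])
qed

lemma funpow_mult_parity_split:
  "{((*v) A ^^ k) b | k. k < m} =
    {((*v) (A ** A) ^^ i) b | i. i < (m + 1) div 2} \<union> (*v) A ` {((*v) (A ** A) ^^ i) b | i. i < m div 2}"
  (is "_ = ?even \<union> (*v) A ` ?odd")
proof (intro set_eqI iffI)
  fix x
  assume "x \<in> {((*v) A ^^ k) b | k. k < m}"
  then obtain k where "k < m" and x: "x = ((*v) A ^^ k) b"
    by blast
  show "x \<in> ?even \<union> (*v) A ` ?odd"
  proof (cases "even k")
    case True
    then obtain i where "k = 2 * i" ..
    then have "x = ((*v) (A ** A) ^^ i) b" and "i < (m + 1) div 2"
      using x \<open>k < m\<close> by (simp_all add: funpow_mult_square)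
    then show ?thesis
      by blast
  next
    case False
    then obtain i where "k = Suc (2 * i)"
      by (auto elim: oddE)
    then have "x = A *v ((*v) (A ** A) ^^ i) b" and "i < m div 2"
      using x \<open>k < m\<close> by (simp_all add: funpow_mult_square)
    then show ?thesis
      by blast
  qed
next
  fix x
  assume "x \<in> ?even \<union> (*v) A ` ?odd"
  then show "x \<in> {((*v) A ^^ k) b | k. k < m}"
  proof
    assume "x \<in> ?even"
    then obtain i where "i < (m + 1) div 2" and "x = ((*v) A ^^ (2 * i)) b"
      by (auto simp: funpow_mult_square)
    then show ?thesis
      by (intro CollectI exI[of _ "2 * i"]) linarith
  next
    assume "x \<in> (*v) A ` ?odd"
    then obtain i where "i < m div 2" and "x = ((*v) A ^^ Suc (2 * i)) b"
      by (auto simp: funpow_mult_square)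
    then show ?thesis
      by (intro CollectI exI[of _ "Suc (2 * i)"]) linarith
  qed
qed

lemma krylov_parity_split:
  "krylov A b m =
    {u + A *v w | u w. u \<in> krylov (A ** A) b ((m + 1) div 2) \<and> w \<in> krylov (A ** A) b (m div 2)}"
  unfolding krylov_def funpow_mult_parity_split[of A b m] span_Un span_linear_image[OF matrix_vector_mul_linear]
  by blast

subsection \<open>Skew-symmetric matrices\<close>

lemma skew_transpose_mult_vector:
  fixes A :: "real^'n^'n"
  assumes "transpose A = - A"
  shows "transpose A *v x = - (A *v x)"
  using assms by (simp add: matrix_vector_mult_def vec_eq_iff sum_negf)

lemma skew_inner_mult:
  fixes A :: "real^'n^'n"
  assumes "transpose A = - A"
  shows "x \<bullet> (A *v y) = - ((A *v x) \<bullet> y)"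
proof -
  have "x \<bullet> (A *v y) = (transpose A *v x) \<bullet> y"
    by (simp add: dot_lmul_matrix)
  also have "\<dots> = - ((A *v x) \<bullet> y)"
    by (simp only: skew_transpose_mult_vector[OF assms] inner_minus_left)
  finally show ?thesis .
qed

lemma skew_image_transpose:
  fixes A :: "real^'n^'n"
  assumes "transpose A = - A" and "subspace E"
  shows "(*v) (transpose A) ` E = (*v) A ` E"
proof -
  have neg: "transpose A *v p = A *v (- p)" for p
    by (simp only: skew_transpose_mult_vector[OF assms(1)] linear_neg[OF matrix_vector_mul_linear])
  have "uminus ` E = E"
  proof (intro subset_antisym image_subsetI subsetI)
    show "- p \<in> E" if "p \<in> E" for p
      using assms(2) that by (rule subspace_neg)
    show "p \<in> uminus ` E" if "p \<in> E" for p
      using subspace_neg[OF assms(2) that] by (intro image_eqI[of _ _ "- p"]) simp_all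
  qed
  have "(*v) (transpose A) ` E = (\<lambda>p. A *v (- p)) ` E"
    by (rule image_cong[OF refl neg])
  also have "\<dots> = (*v) A ` uminus ` E"
    by (simp only: image_image)
  finally show ?thesis
    using \<open>uminus ` E = E\<close> by simp
qed

lemma skew_funpow_inner:
  fixes A :: "real^'n^'n"
  assumes "transpose A = - A"
  shows "((*v) A ^^ n) x \<bullet> y = (-1) ^ n * (x \<bullet> ((*v) A ^^ n) y)"
proof (induction n arbitrary: y)
  case (Suc n)
  have "((*v) A ^^ Suc n) x \<bullet> y = - (((*v) A ^^ n) x \<bullet> (A *v y))"
    using skew_inner_mult[OF assms, of "((*v) A ^^ n) x" y] by simp
  also have "\<dots> = - ((-1) ^ n * (x \<bullet> ((*v) A ^^ Suc n) y))"
    using Suc.IH by (simp add: funpow_swap1)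
  finally show ?case
    by simp
qed simp

lemma skew_inner_odd_power:
  fixes A :: "real^'n^'n"
  assumes "transpose A = - A"
  shows "b \<bullet> ((*v) A ^^ Suc (2 * m)) b = 0"
proof -
  have "((*v) A ^^ Suc (2 * m)) b = ((*v) A ^^ m) (A *v ((*v) A ^^ m) b)"
    by (simp add: funpow_add[symmetric, THEN fun_cong, simplified] funpow_swap1 mult_2)
  then have "b \<bullet> ((*v) A ^^ Suc (2 * m)) b = (-1) ^ m * (((*v) A ^^ m) b \<bullet> (A *v ((*v) A ^^ m) b))"
    using skew_funpow_inner[OF assms, of m b] by simp
  also have "((*v) A ^^ m) b \<bullet> (A *v ((*v) A ^^ m) b) = 0"
    using skew_inner_mult[OF assms, of "((*v) A ^^ m) b" "((*v) A ^^ m) b"] by (simp add: inner_commute)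
  finally show ?thesis
    by simp
qed

lemma skew_krylov_square_orthogonal:
  fixes A :: "real^'n^'n"
  assumes skew: "transpose A = - A"
    and "u \<in> krylov (A ** A) b m" and "w \<in> krylov (A ** A) b m"
  shows "u \<bullet> (A *v w) = 0"
proof -
  let ?G = "{((*v) (A ** A) ^^ k) b | k. k < m}"
  have bf: "bilinear (\<lambda>u w. u \<bullet> (A *v w))"
    by (simp add: bilinear_def linear_iff inner_add_left inner_add_right
        matrix_vector_right_distrib matrix_vector_mult_scaleR)
  have bg: "bilinear (\<lambda>u w. 0 :: real)"
    by (simp add: bilinear_def linear_iff)
  have span: "krylov (A ** A) b m \<subseteq> span ?G"
    by (simp add: krylov_def)
  have "g \<bullet> (A *v g') = 0" if "g \<in> ?G" and "g' \<in> ?G" for g g'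
  proof -
    obtain i j where g: "g = ((*v) A ^^ (2 * i)) b" and g': "g' = ((*v) A ^^ (2 * j)) b"
      using \<open>g \<in> ?G\<close> \<open>g' \<in> ?G\<close> by (auto simp: funpow_mult_square)
    have "((*v) A ^^ (2 * i)) (A *v g') = ((*v) A ^^ Suc (2 * (i + j))) b"
      unfolding g' by (simp add: funpow_add[symmetric, THEN fun_cong, simplified] funpow_swap1 algebra_simps)
    then show ?thesis
      using skew_funpow_inner[OF skew, of "2 * i" b "A *v g'"] skew_inner_odd_power[OF skew, of b "i + j"] g
      by (simp add: distrib_left)
  qed
  then show ?thesis
    using bilinear_eq[OF bf bg span span assms(2,3)] by simp
qed

text \<open>The residual of an iterate taken from \<open>A E\<^sub>q\<close> lies in \<open>E\<^sub>q\<^sub>+\<^sub>1\<close>.\<close>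

lemma skew_residual_orthogonal:
  fixes A :: "real^'n^'n"
  assumes skew: "transpose A = - A"
    and "w \<in> krylov (A ** A) b q" and "u \<in> krylov (A ** A) b (Suc q)"
  shows "(A *v u) \<bullet> (b - A *v (A *v w)) = 0"
proof -
  have "A *v (A *v w) \<in> krylov (A ** A) b (Suc q)"
    using krylov_mult_Suc[OF assms(2)] by (simp add: matrix_vector_mul_assoc)
  then have "b - A *v (A *v w) \<in> krylov (A ** A) b (Suc q)"
    by (intro subspace_diff subspace_krylov start_mem_krylov) simp_all
  then show ?thesis
    using skew_krylov_square_orthogonal[OF skew assms(3)] skew_inner_mult[OF skew, of u] by simp
qed

lemma skew_petrov_galerkin_normal_imp_galerkin:
  fixes A :: "real^'n^'n"
  assumes skew: "transpose A = - A"
    and cgne: "petrov_galerkin (krylov (A ** A) (A *v b) q) (krylov (A ** A) b q) A b x"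
  shows "petrov_galerkin (krylov A b (2 * q)) (krylov A b (2 * q)) A b x"
proof -
  let ?E = "krylov (A ** A) b q"
  obtain w\<^sub>0 where w\<^sub>0: "w\<^sub>0 \<in> ?E" and x: "x = A *v w\<^sub>0"
    and orth: "\<forall>p\<in>?E. p \<bullet> (b - A *v x) = 0"
    using cgne by (auto simp: petrov_galerkin_def krylov_square_mult_start)
  have split: "krylov A b (2 * q) = {u + A *v w | u w. u \<in> ?E \<and> w \<in> ?E}"
    using krylov_parity_split[of A b "2 * q"] by simp
  have "x = 0 + A *v w\<^sub>0"
    using x by simp
  then have "x \<in> krylov A b (2 * q)"
    unfolding split using w\<^sub>0 subspace_0[OF subspace_krylov] by blast
  moreover have "p \<bullet> (b - A *v x) = 0" if p: "p \<in> krylov A b (2 * q)" for p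
  proof -
    obtain u w where "u \<in> ?E" and "w \<in> ?E" and "p = u + A *v w"
      using p unfolding split by blast
    moreover have "(A *v w) \<bullet> (b - A *v x) = 0"
      using skew_residual_orthogonal[OF skew w\<^sub>0] krylov_mono[of q "Suc q"] \<open>w \<in> ?E\<close> x by auto
    ultimately show ?thesis
      using orth by (simp add: inner_add_left)
  qed
  ultimately show ?thesis
    unfolding petrov_galerkin_def by blast
qed

lemma skew_galerkin_krylov_unique:
  fixes A :: "real^'n^'n"
  assumes skew: "transpose A = - A" and "invertible A"
    and x: "petrov_galerkin (krylov A b (2 * q)) (krylov A b (2 * q)) A b x"
    and y: "petrov_galerkin (krylov A b (2 * q)) (krylov A b (2 * q)) A b y"
  shows "x = y"
proof -
  let ?E = "krylov (A ** A) b q" and ?V = "krylov A b (2 * q)"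
  have split: "?V = {u + A *v w | u w. u \<in> ?E \<and> w \<in> ?E}"
    using krylov_parity_split[of A b "2 * q"] by simp
  have "x - y \<in> ?V"
    using x y subspace_krylov subspace_diff unfolding petrov_galerkin_def by blast
  then obtain u w where u: "u \<in> ?E" and w: "w \<in> ?E" and d: "x - y = u + A *v w"
    unfolding split by blast
  have orth: "p \<bullet> (A *v u + A *v (A *v w)) = 0" if "p \<in> ?V" for p
  proof -
    have "p \<bullet> (b - A *v x) = 0" and "p \<bullet> (b - A *v y) = 0"
      using x y that unfolding petrov_galerkin_def by auto
    then have "p \<bullet> (A *v (x - y)) = 0"
      by (simp add: matrix_vector_mult_diff_distrib inner_diff_right)
    then show ?thesis
      by (simp add: d matrix_vector_right_distrib)
  qed
  \<comment> \<open>Testing against \<open>w\<close> kills the odd part \<open>A w\<close>, then testing against \<open>A u\<close> kills \<open>u\<close>.\<close>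
  have "w = w + A *v 0" and "A *v u = 0 + A *v u"
    by simp_all
  then have "w \<in> ?V" and "A *v u \<in> ?V"
    unfolding split using u w subspace_0[OF subspace_krylov] by blast+
  have "w \<bullet> (A *v u) = 0"
    using skew_krylov_square_orthogonal[OF skew w u] .
  then have "w \<bullet> (A *v (A *v w)) = 0"
    using orth[OF \<open>w \<in> ?V\<close>] by (simp add: inner_add_right)
  then have Aw: "A *v w = 0"
    using skew_inner_mult[OF skew, of w "A *v w"] by simp
  then have "(A *v u) \<bullet> (A *v u) = 0"
    using orth[OF \<open>A *v u \<in> ?V\<close>] by simp
  then have "u = 0"
    using assms(2) unfolding invertible_left_inverse matrix_left_invertible_ker by simp
  with d Aw show "x = y"
    by simp
qed

lemma skew_normal_residual_imp_krylov_residual: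
  fixes A :: "real^'n^'n"
  assumes skew: "transpose A = - A" and "m div 2 = q"
    and x: "x \<in> krylov (A ** A) (A *v b) q"
    and cgnr: "\<forall>v\<in>krylov (A ** A) (A *v b) q. (A *v v) \<bullet> (b - A *v x) = 0"
  shows "x \<in> krylov A b m" and "\<forall>v\<in>krylov A b m. (A *v v) \<bullet> (b - A *v x) = 0"
proof -
  let ?E = "krylov (A ** A) b q" and ?F = "krylov (A ** A) b (Suc q)"
  obtain w\<^sub>0 where w\<^sub>0: "w\<^sub>0 \<in> ?E" and x: "x = A *v w\<^sub>0"
    using x by (auto simp: krylov_square_mult_start)
  have split: "krylov A b m = {u + A *v w | u w. u \<in> krylov (A ** A) b ((m + 1) div 2) \<and> w \<in> ?E}"
    using krylov_parity_split[of A b m] assms(2) by simp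
  have even_part: "krylov (A ** A) b ((m + 1) div 2) \<subseteq> ?F"
    using assms(2) by (intro krylov_mono) linarith
  have "x = 0 + A *v w\<^sub>0"
    using x by simp
  then show "x \<in> krylov A b m"
    unfolding split using w\<^sub>0 subspace_0[OF subspace_krylov] by blast
  show "\<forall>v\<in>krylov A b m. (A *v v) \<bullet> (b - A *v x) = 0"
  proof
    fix v
    assume "v \<in> krylov A b m"
    then obtain u w where "u \<in> ?F" and "w \<in> ?E" and v: "v = u + A *v w"
      unfolding split using even_part by blast
    have "(A *v u) \<bullet> (b - A *v x) = 0"
      using skew_residual_orthogonal[OF skew w\<^sub>0 \<open>u \<in> ?F\<close>] x by simp
    moreover have "(A *v (A *v w)) \<bullet> (b - A *v x) = 0"
      using cgnr \<open>w \<in> ?E\<close> by (auto simp: krylov_square_mult_start)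
    ultimately show "(A *v v) \<bullet> (b - A *v x) = 0"
      by (simp add: v matrix_vector_right_distrib inner_add_left)
  qed
qed

theorem theorem1:
  fixes A :: "real^'n^'n" and b :: "real^'n" and q :: nat
  assumes skew: "transpose A = - A"
    and nonsing: "invertible A"
  shows
    "(\<exists>!x. petrov_galerkin (krylov (A ** A) (A *v b) q) (krylov (A ** A) b q) A b x)
     \<and> (\<forall>x. petrov_galerkin (krylov (A ** A) (A *v b) q) (krylov (A ** A) b q) A b x \<longrightarrow>
            x \<in> krylov A b (2*q) \<and> (\<forall>p\<in>krylov A b (2*q). p \<bullet> (b - A *v x) = 0))
     \<and> (\<exists>!x. petrov_galerkin (krylov A b (2*q)) (krylov A b (2*q)) A b x)
     \<and> (THE x. petrov_galerkin (krylov A b (2*q)) (krylov A b (2*q)) A b x)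
         = (THE x. petrov_galerkin (krylov (A ** A) (A *v b) q) (krylov (A ** A) b q) A b x)
     \<and> (\<exists>!x. min_residual (krylov (A ** A) (A *v b) q) A b x)
     \<and> (\<exists>!x. min_residual (krylov A b (2*q)) A b x)
     \<and> (\<exists>!x. min_residual (krylov A b (2*q+1)) A b x)
     \<and> (THE x. min_residual (krylov (A ** A) (A *v b) q) A b x)
         = (THE x. min_residual (krylov A b (2*q)) A b x)
     \<and> (THE x. min_residual (krylov A b (2*q+1)) A b x)
         = (THE x. min_residual (krylov A b (2*q)) A b x)"
proof -
  let ?E = "krylov (A ** A) b q" and ?W = "krylov (A ** A) (A *v b) q"
    and ?V\<^sub>2 = "krylov A b (2 * q)" and ?V\<^sub>3 = "krylov A b (2 * q + 1)"
  have "?W = (*v) (transpose A) ` ?E"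
    by (simp only: krylov_square_mult_start skew_image_transpose[OF skew subspace_krylov])
  then have cgne: "\<exists>!x. petrov_galerkin ?W ?E A b x"
    using ex1_petrov_galerkin_transpose_image[OF subspace_krylov nonsing] by simp
  then obtain x\<^sub>E where x\<^sub>E: "petrov_galerkin ?W ?E A b x\<^sub>E"
    by blast
  have galerkin: "petrov_galerkin ?V\<^sub>2 ?V\<^sub>2 A b x\<^sub>E"
    using skew_petrov_galerkin_normal_imp_galerkin[OF skew x\<^sub>E] .
  have galerkin_unique: "\<exists>!x. petrov_galerkin ?V\<^sub>2 ?V\<^sub>2 A b x"
    using galerkin skew_galerkin_krylov_unique[OF skew nonsing] by blast
  obtain x\<^sub>R where x\<^sub>R: "x\<^sub>R \<in> ?W" and cgnr: "\<forall>v\<in>?W. (A *v v) \<bullet> (b - A *v x\<^sub>R) = 0"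
    using ex_residual_orthogonal[OF subspace_krylov] .
  note minres = skew_normal_residual_imp_krylov_residual[OF skew _ x\<^sub>R cgnr]
  have "(THE x. min_residual ?W A b x) = x\<^sub>R"
    and "(THE x. min_residual ?V\<^sub>2 A b x) = x\<^sub>R"
    and "(THE x. min_residual ?V\<^sub>3 A b x) = x\<^sub>R"
    using x\<^sub>R cgnr minres[of "2 * q"] minres[of "2 * q + 1"]
    by (simp_all add: the_min_residual_eqI[OF subspace_krylov nonsing])
  with cgne x\<^sub>E galerkin galerkin_unique show ?thesis
    using skew_petrov_galerkin_normal_imp_galerkin[OF skew]
    by (simp add: the1_equality petrov_galerkin_def ex1_min_residual[OF subspace_krylov nonsing])
qed

end
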